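(* Let $d\geq 2$ be a fixed integer and let $p\in\mathbb{R}[x]$ be a nonconstant polynomial with positive real coefficients summing to $1$; that is, $p=p_0+p_1x+\cdots+p_mx^m$ with $m\geq 1$, $p_i>0$ for all $0\leq i\leq m$, and $\sum_{i=0}^m p_i=1$. Then for all integers $0\leq j\leq d-1$, $$\lim_{n\rightarrow\infty}\ \sum_{k\geq 0,\ k\equiv j \bmod d}(p^n)_k=\frac 1d,$$ where $(p^n)_k$ denotes the coefficient of $x^k$ in the standard expansion $p^n=(p^n)_0+(p^n)_1x+(p^n)_2x^2+\cdots$.
   Context: A polynomial with positive coefficients means that every coefficient from the constant term up to the leading term is a positive real number. Coefficients of $x^k$ with $k$ greater than the degree are $0$, so the sums are finite. *)

theory Defs
  imports
    Complex_Main
    "HOL-Computational_Algebra.Polynomial"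
    "HOL-Number_Theory.Cong"
begin

end

theory Submission
  imports Defs
begin

text \<open>
  The roots of unity filter writes the sum over one residue class as
  \<open>1/d\<close> times the sum over the \<open>d\<close>-th roots of unity \<open>z\<close> of \<open>z^{-j} p(z)^n\<close>. The root \<open>z = 1\<close>
  contributes \<open>1\<close>. For \<open>z \<noteq> 1\<close> the inequality \<open>|p\<^sub>0 + p\<^sub>1 z| < p\<^sub>0 + p\<^sub>1\<close> gives \<open>|p(z)| < 1\<close>, so
  the remaining terms vanish in the limit.
\<close>

text \<open>Cosine takes the value 1 only at integer multiples of 2 pi. The index \<open>m\<close>
  is an integer because it later becomes a difference of exponents, which may be negative.\<close>

lemma cis_unity_eq_1_iff:
  fixes d :: nat and m :: int
  assumes "d > 0"
  shows "cis (2 * pi * of_int m / of_nat d) = 1 \<longleftrightarrow> int d dvd m"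
proof
  assume "cis (2 * pi * of_int m / of_nat d) = 1"
  then have "cos (2 * pi * of_int m / of_nat d) = 1"
    by (simp add: complex_eq_iff)
  then obtain n :: int where "2 * pi * of_int m / of_nat d = of_int n * 2 * pi"
    using cos_one_2pi_int by blast
  then have "real_of_int m = of_int (n * int d)"
    using assms by (simp add: field_simps)
  then have "m = n * int d"
    by (simp only: of_int_eq_iff)
  then show "int d dvd m"
    by simp
next
  assume "int d dvd m"
  then obtain n where "m = int d * n" ..
  then have "2 * pi * of_int m / of_nat d = 2 * pi * of_int n"
    using assms by simp
  then show "cis (2 * pi * of_int m / of_nat d) = 1"
    by (simp add: cis_multiple_2pi)
qed

text \<open>On the unit circle conjugation is inversion, so the summands form a geometric
  progression whose ratio is a \<open>d\<close>-th root of unity; its sum vanishes unless the ratio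
  is 1.\<close>

lemma sum_roots_of_unity_filter:
  fixes d j k :: nat
  assumes "d > 0"
  shows "(\<Sum>r<d. cis (2 * pi * r / d) ^ k * cnj (cis (2 * pi * r / d)) ^ j)
    = (if [k = j] (mod d) then of_nat d else 0)"
proof -
  \<comment> \<open>The subtraction is done in \<open>int\<close>, since on \<open>nat\<close> it
    would truncate when \<open>k < j\<close>.\<close>
  define z where "z = cis (2 * pi * of_int (int k - int j) / d)"
  have term_eq: "cis (2 * pi * r / d) ^ k * cnj (cis (2 * pi * r / d)) ^ j = z ^ r" for r :: nat
    by (simp add: z_def cis_cnj DeMoivre cis_mult field_simps diff_divide_distrib)
  have z_eq_1: "z = 1 \<longleftrightarrow> [k = j] (mod d)"
    unfolding z_def cis_unity_eq_1_iff[OF assms]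
    by (simp add: cong_iff_dvd_diff flip: cong_int_iff)
  have "z ^ d = cis (2 * pi * of_int (int k - int j))"
    using assms by (simp add: z_def DeMoivre)
  then have "z ^ d = 1"
    by (metis Ints_of_int cis_multiple_2pi)
  then have "(\<Sum>r<d. z ^ r) = (if z = 1 then of_nat d else 0)"
    by (simp add: geometric_sum)
  then show ?thesis
    by (simp only: term_eq z_eq_1)
qed

lemma map_poly_of_real_mult:
  "map_poly complex_of_real (p * q) = map_poly complex_of_real p * map_poly complex_of_real q"
  by (intro poly_eqI) (simp add: coeff_map_poly coeff_mult)

lemma map_poly_of_real_power:
  "map_poly complex_of_real (p ^ n) = map_poly complex_of_real p ^ n"
  by (induction n) (simp_all add: map_poly_of_real_mult)

text \<open>Passes between the coefficients of \<open>p ^ n\<close> and powers of the complex value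
  of \<open>p\<close>; the case of exponent 1 also serves as the expansion of \<open>p\<close>
  itself.\<close>

lemma sum_coeff_of_real_power:
  "(\<Sum>k\<le>degree (p ^ n). complex_of_real (coeff (p ^ n) k) * z ^ k)
    = poly (map_poly complex_of_real p) z ^ n"
proof -
  have "(\<Sum>k\<le>degree (p ^ n). complex_of_real (coeff (p ^ n) k) * z ^ k)
    = poly (map_poly complex_of_real (p ^ n)) z"
    by (simp add: poly_altdef coeff_map_poly degree_map_poly)
  then show ?thesis
    by (simp add: map_poly_of_real_power)
qed

text \<open>The squared norm is \<open>a^2 + b^2 + 2 * a * b * Re z\<close>, and
  \<open>Re z < 1\<close> at every point of the unit circle other than 1.\<close>

lemma norm_add_mult_unit_less:
  fixes a b :: real and z :: complex
  assumes "a > 0" "b > 0" "norm z = 1" "z \<noteq> 1"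
  shows "norm (of_real a + of_real b * z) < a + b"
proof (rule power2_less_imp_less)
  have unit: "(Re z)\<^sup>2 + (Im z)\<^sup>2 = 1"
    using assms(3) by (simp add: cmod_def)
  have "Re z \<noteq> 1"
    using unit assms(4) by (auto simp: complex_eq_iff)
  moreover have "Re z \<le> 1"
    using complex_Re_le_cmod[of z] assms(3) by simp
  ultimately have "a * b * Re z < a * b"
    using assms by simp
  moreover have "(norm (of_real a + of_real b * z))\<^sup>2 = a\<^sup>2 + b\<^sup>2 * ((Re z)\<^sup>2 + (Im z)\<^sup>2) + 2 * (a * b * Re z)"
    unfolding cmod_power2 by (simp add: power2_eq_square algebra_simps)
  ultimately show "(norm (of_real a + of_real b * z))\<^sup>2 < (a + b)\<^sup>2"
    unfolding unit by (simp add: power2_sum)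
qed (use assms in simp)

text \<open>Strictness comes from the terms of index 0 and 1 alone, both present because the degree
  is at least 1; the triangle inequality bounds the rest. Adjacent indices matter: for
  \<open>1 + x^2\<close> equality holds at -1.\<close>

lemma norm_poly_of_real_less:
  fixes p :: "real poly" and z :: complex
  assumes "degree p \<ge> 1" and pos: "\<forall>i \<le> degree p. coeff p i > 0"
    and z: "norm z = 1" "z \<noteq> 1"
  shows "norm (poly (map_poly complex_of_real p) z) < (\<Sum>i \<le> degree p. coeff p i)"
proof -
  have split: "{..degree p} = {..1} \<union> {2..degree p}" "{..1} \<inter> {2..degree p} = {}"
    using assms(1) by auto
  let ?f = "\<lambda>i. complex_of_real (coeff p i) * z ^ i"
  have "norm (\<Sum>i\<le>1. ?f i) < (\<Sum>i\<le>1. coeff p i)"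
    using norm_add_mult_unit_less[of "coeff p 0" "coeff p 1" z] assms by simp
  moreover have "norm (\<Sum>i\<in>{2..degree p}. ?f i) \<le> (\<Sum>i\<in>{2..degree p}. coeff p i)"
    using pos z by (intro sum_norm_le) (auto simp: norm_mult norm_power abs_of_pos)
  ultimately have "norm ((\<Sum>i\<le>1. ?f i) + (\<Sum>i\<in>{2..degree p}. ?f i))
      < (\<Sum>i\<le>1. coeff p i) + (\<Sum>i\<in>{2..degree p}. coeff p i)"
    by (meson norm_triangle_ineq add_less_le_mono le_less_trans)
  also have "\<dots> = (\<Sum>i\<le>degree p. coeff p i)"
    unfolding split(1) by (rule sum.union_disjoint[symmetric]) (use split(2) in auto)
  also have "(\<Sum>i\<le>1. ?f i) + (\<Sum>i\<in>{2..degree p}. ?f i) = (\<Sum>i\<le>degree p. ?f i)"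
    unfolding split(1) by (rule sum.union_disjoint[symmetric]) (use split(2) in auto)
  also have "(\<Sum>i\<le>degree p. ?f i) = poly (map_poly complex_of_real p) z"
    using sum_coeff_of_real_power[of p 1 z] by simp
  finally show ?thesis .
qed

text \<open>Expanding each power into coefficients and exchanging the finite sums leaves the filter
  as inner sum. The range of \<open>r\<close> does not depend on \<open>n\<close>, so limits can be
  taken termwise.\<close>

lemma residue_class_sum_eq:
  fixes p :: "real poly" and d j n :: nat
  assumes "d > 0"
  shows "complex_of_real (\<Sum>k \<in> {k. k \<le> degree (p ^ n) \<and> [k = j] (mod d)}. coeff (p ^ n) k)
    = (\<Sum>r<d. cnj (cis (2 * pi * r / d)) ^ j
        * poly (map_poly complex_of_real p) (cis (2 * pi * r / d)) ^ n) / of_nat d"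
proof -
  let ?e = "\<lambda>r::nat. cis (2 * pi * r / d)" and ?c = "\<lambda>k. complex_of_real (coeff (p ^ n) k)"
  have "(\<Sum>r<d. cnj (?e r) ^ j * poly (map_poly complex_of_real p) (?e r) ^ n)
    = (\<Sum>r<d. \<Sum>k\<le>degree (p ^ n). ?c k * (?e r ^ k * cnj (?e r) ^ j))"
    by (simp add: sum_distrib_left mult_ac flip: sum_coeff_of_real_power)
  also have "\<dots> = (\<Sum>k\<le>degree (p ^ n). ?c k * (\<Sum>r<d. ?e r ^ k * cnj (?e r) ^ j))"
    by (subst sum.swap) (simp add: sum_distrib_left)
  also have "\<dots> = (\<Sum>k\<le>degree (p ^ n). if [k = j] (mod d) then ?c k * of_nat d else 0)"
    by (intro sum.cong refl) (simp add: sum_roots_of_unity_filter[OF assms])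
  also have "\<dots> = (\<Sum>k \<in> {k. k \<le> degree (p ^ n) \<and> [k = j] (mod d)}. ?c k * of_nat d)"
    by (simp add: sum.inter_filter[symmetric])
  finally show ?thesis
    using assms by (simp flip: sum_distrib_right)
qed

theorem theorem1:
  fixes d :: nat and p :: "real poly"
  assumes "d \<ge> 2"
    and "degree p \<ge> 1"
    and "\<forall>i \<le> degree p. coeff p i > 0"
    and "(\<Sum>i \<le> degree p. coeff p i) = 1"
  shows "\<forall>j \<le> d - 1.
    (\<lambda>n. \<Sum>k \<in> {k. k \<le> degree (p ^ n) \<and> [k = j] (mod d)}. coeff (p ^ n) k)
      \<longlonglongrightarrow> 1 / real d"
proof (intro allI impI)
  fix j
  let ?e = "\<lambda>r::nat. cis (2 * pi * r / d)" and ?P = "poly (map_poly complex_of_real p)"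
  have d: "d > 0"
    using assms(1) by simp
  have "?P 1 = of_real (\<Sum>i\<le>degree p. coeff p i)"
    using sum_coeff_of_real_power[of p 1 1] by simp
  then have P1: "?P 1 = 1"
    using assms(4) by simp
  have "(\<lambda>n. cnj (?e r) ^ j * ?P (?e r) ^ n) \<longlonglongrightarrow> (if r = 0 then 1 else 0)" if "r < d" for r
  proof (cases "r = 0")
    case True
    then show ?thesis
      by (simp add: P1)
  next
    case False
    \<comment> \<open>Here \<open>0 < r < d\<close>, so \<open>r\<close> is no multiple of
      \<open>d\<close> and the root differs from 1.\<close>
    then have "\<not> int d dvd int r"
      using that by (auto dest: dvd_imp_le)
    then have "?e r \<noteq> 1"
      using cis_unity_eq_1_iff[OF d, of "int r"] by simp
    then have "norm (?P (?e r)) < 1"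
      using norm_poly_of_real_less[of p "?e r"] assms by simp
    then show ?thesis
      using False by (simp add: LIMSEQ_power_zero tendsto_mult_right_zero)
  qed
  then have "(\<lambda>n. (\<Sum>r<d. cnj (?e r) ^ j * ?P (?e r) ^ n) / of_nat d)
      \<longlonglongrightarrow> (\<Sum>r<d. if r = 0 then 1 else 0) / of_nat d"
    using d by (intro tendsto_intros) auto
  then have "(\<lambda>n. complex_of_real (\<Sum>k \<in> {k. k \<le> degree (p ^ n) \<and> [k = j] (mod d)}. coeff (p ^ n) k))
      \<longlonglongrightarrow> complex_of_real (1 / real d)"
    \<comment> \<open>The embedding must stay outside the sum for the filter identity to
      match.\<close>
    using d by (simp add: residue_class_sum_eq del: of_real_sum)
  then show "(\<lambda>n. \<Sum>k \<in> {k. k \<le> degree (p ^ n) \<and> [k = j] (mod d)}. coeff (p ^ n) k)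
      \<longlonglongrightarrow> 1 / real d"
    by (simp only: tendsto_of_real_iff)
qed

end
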